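(* Let $T$ be a nonabelian embedding tensor on a Lie algebra $\mathfrak g$ with respect to a coherent action $(\mathfrak h;\rho)$. Then for any Nijenhuis element $x\in\mathrm{Nij}(T)$, $T_t=T+t\mathfrak T$ with $\mathfrak T=\partial_Tx$, i.e. $\mathfrak T(u)=T\rho(x)u-[x,Tu]_{\mathfrak g}$ for all $u\in\mathfrak h$, is a trivial linear deformation of the nonabelian embedding tensor $T$.
   Context: All vector spaces are over $\mathbb C$. A coherent action of a Lie algebra $\mathfrak g$ on a Lie algebra $\mathfrak h$, denoted $(\mathfrak h;\rho)$, is a Lie algebra homomorphism $\rho:\mathfrak g\to\mathrm{Der}(\mathfrak h)$ such that $[\rho(x)u,v]_{\mathfrak h}=0$ for all $x\in\mathfrak g$, $u,v\in\mathfrak h$. A nonabelian embedding tensor on $\mathfrak g$ with respect to $(\mathfrak h;\rho)$ is a linear map $T:\mathfrak h\to\mathfrak g$ with $[Tu,Tv]_{\mathfrak g}=T\big(\rho(Tu)(v)+[u,v]_{\mathfrak h}\big)$ for all $u,v\in\mathfrak h$. A homomorphism from a nonabelian embedding tensor $T'$ to a nonabelian embedding tensor $T$ (both on $\mathfrak g$ with respect to $(\mathfrak h;\rho)$) is a pair $(\phi_{\mathfrak g},\phi_{\mathfrak h})$ of Lie algebra homomorphisms $\phi_{\mathfrak g}:\mathfrak g\to\mathfrak g$, $\phi_{\mathfrak h}:\mathfrak h\to\mathfrak h$ with $T\circ\phi_{\mathfrak h}=\phi_{\mathfrak g}\circ T'$ and $\phi_{\mathfrak h}(\rho(x)u)=\rho(\phi_{\mathfrak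 g}(x))\phi_{\mathfrak h}(u)$ for all $x\in\mathfrak g$, $u\in\mathfrak h$. A linear map $\mathfrak T:\mathfrak h\to\mathfrak g$ generates a linear deformation $T_t=T+t\mathfrak T$ of $T$ if $T+t\mathfrak T$ is a nonabelian embedding tensor on $\mathfrak g$ with respect to $(\mathfrak h;\rho)$ for all $t\in\mathbb C$. A linear deformation $T_t=T+t\mathfrak T$ is trivial if there exists $x\in\mathfrak g$ such that, for all $t\in\mathbb C$, $(\mathrm{Id}_{\mathfrak g}+t\,\mathrm{ad}_x,\mathrm{Id}_{\mathfrak h}+t\rho(x))$ is a homomorphism from $T_t$ to $T$, where $\mathrm{ad}_x(y)=[x,y]_{\mathfrak g}$. An element $x\in\mathfrak g$ is a Nijenhuis element associated to $T$ if (i) $[[x,y]_{\mathfrak g},[x,z]_{\mathfrak g}]_{\mathfrak g}=0$ for all $y,z\in\mathfrak g$; (ii) $\rho([x,y]_{\mathfrak g})\rho(x)=0$ for all $y\in\mathfrak g$; (iii) $[x,T\rho(x)u-[x,Tu]_{\mathfrak g}]_{\mathfrak g}=0$ for all $u\in\mathfrak h$. $\mathrm{Nij}(T)$ denotes the set of Nijenhuis elements associated to $T$. *)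

theory Defs
  imports Complex_Main
begin

locale lie_algebra = vector_space scale
  for scale :: "complex \<Rightarrow> 'a::ab_group_add \<Rightarrow> 'a" +
  fixes bracket :: "'a \<Rightarrow> 'a \<Rightarrow> 'a"
  assumes linear_bracket_left: "Vector_Spaces.linear scale scale (\<lambda>x. bracket x y)"
    and linear_bracket_right: "Vector_Spaces.linear scale scale (\<lambda>y. bracket x y)"
    and bracket_self: "bracket x x = 0"
    and jacobi: "bracket x (bracket y z) + bracket y (bracket z x) + bracket z (bracket x y) = 0"
begin

definition Der :: "('a \<Rightarrow> 'a) set" where
  "Der = {D. Vector_Spaces.linear scale scale D \<and>
             (\<forall>u v. D (bracket u v) = bracket (D u) v + bracket u (D v))}"

end

locale lie_algebra_hom =
  source: lie_algebra scale1 bracket1 + target: lie_algebra scale2 bracket2 +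
  Vector_Spaces.linear scale1 scale2 f
  for scale1 :: "complex \<Rightarrow> 'a::ab_group_add \<Rightarrow> 'a" and bracket1 :: "'a \<Rightarrow> 'a \<Rightarrow> 'a"
    and scale2 :: "complex \<Rightarrow> 'b::ab_group_add \<Rightarrow> 'b" and bracket2 :: "'b \<Rightarrow> 'b \<Rightarrow> 'b"
    and f :: "'a \<Rightarrow> 'b" +
  assumes hom_bracket: "f (bracket1 x y) = bracket2 (f x) (f y)"

text \<open>
  The axioms \<open>action_Der\<close> to \<open>action_bracket\<close> say that \<open>\<rho>\<close> is a homomorphism
  of Lie algebras into the derivations of the second algebra, where derivations carry the
  pointwise linear structure and the commutator bracket.
\<close>

locale coherent_action =
  g: lie_algebra scaleg bracketg + h: lie_algebra scaleh bracketh
  for scaleg :: "complex \<Rightarrow> 'g::ab_group_add \<Rightarrow> 'g" and bracketg :: "'g \<Rightarrow> 'g \<Rightarrow> 'g"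
    and scaleh :: "complex \<Rightarrow> 'h::ab_group_add \<Rightarrow> 'h" and bracketh :: "'h \<Rightarrow> 'h \<Rightarrow> 'h" +
  fixes \<rho> :: "'g \<Rightarrow> 'h \<Rightarrow> 'h"
  assumes action_Der: "\<rho> x \<in> h.Der"
    and action_add: "\<rho> (x + y) u = \<rho> x u + \<rho> y u"
    and action_scale: "\<rho> (scaleg c x) u = scaleh c (\<rho> x u)"
    and action_bracket: "\<rho> (bracketg x y) u = \<rho> x (\<rho> y u) - \<rho> y (\<rho> x u)"
    and coherent: "bracketh (\<rho> x u) v = 0"
begin

definition nonabelian_embedding_tensor :: "('h \<Rightarrow> 'g) \<Rightarrow> bool" where
  "nonabelian_embedding_tensor T \<longleftrightarrow>
     Vector_Spaces.linear scaleh scaleg T \<and>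
     (\<forall>u v. bracketg (T u) (T v) = T (\<rho> (T u) v + bracketh u v))"

definition embedding_tensor_hom ::
  "('h \<Rightarrow> 'g) \<Rightarrow> ('h \<Rightarrow> 'g) \<Rightarrow> ('g \<Rightarrow> 'g) \<Rightarrow> ('h \<Rightarrow> 'h) \<Rightarrow> bool" where
  "embedding_tensor_hom T' T \<phi>g \<phi>h \<longleftrightarrow>
     nonabelian_embedding_tensor T' \<and> nonabelian_embedding_tensor T \<and>
     lie_algebra_hom scaleg bracketg scaleg bracketg \<phi>g \<and>
     lie_algebra_hom scaleh bracketh scaleh bracketh \<phi>h \<and>
     T \<circ> \<phi>h = \<phi>g \<circ> T' \<and>
     (\<forall>x u. \<phi>h (\<rho> x u) = \<rho> (\<phi>g x) (\<phi>h u))"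

definition deform :: "('h \<Rightarrow> 'g) \<Rightarrow> ('h \<Rightarrow> 'g) \<Rightarrow> complex \<Rightarrow> 'h \<Rightarrow> 'g" where
  "deform T S t = (\<lambda>u. T u + scaleg t (S u))"

definition generates_linear_deformation :: "('h \<Rightarrow> 'g) \<Rightarrow> ('h \<Rightarrow> 'g) \<Rightarrow> bool" where
  "generates_linear_deformation T S \<longleftrightarrow>
     Vector_Spaces.linear scaleh scaleg S \<and>
     (\<forall>t. nonabelian_embedding_tensor (deform T S t))"

definition trivial_linear_deformation :: "('h \<Rightarrow> 'g) \<Rightarrow> ('h \<Rightarrow> 'g) \<Rightarrow> bool" where
  "trivial_linear_deformation T S \<longleftrightarrow>
     generates_linear_deformation T S \<and>
     (\<exists>x. \<forall>t. embedding_tensor_hom (deform T S t) T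
        (\<lambda>y. y + scaleg t (bracketg x y)) (\<lambda>u. u + scaleh t (\<rho> x u)))"

definition Nij :: "('h \<Rightarrow> 'g) \<Rightarrow> 'g set" where
  "Nij T = {x.
     (\<forall>y z. bracketg (bracketg x y) (bracketg x z) = 0) \<and>
     (\<forall>y u. \<rho> (bracketg x y) (\<rho> x u) = 0) \<and>
     (\<forall>u. bracketg x (T (\<rho> x u) - bracketg x (T u)) = 0)}"

definition coboundary :: "('h \<Rightarrow> 'g) \<Rightarrow> 'g \<Rightarrow> 'h \<Rightarrow> 'g" where
  "coboundary T x = (\<lambda>u. T (\<rho> x u) - bracketg x (T u))"

end

end

theory Submission
  imports Defs
begin

text \<open>
  Put \<open>\<phi>\<^sub>t = Id + t ad\<^sub>x\<close> on \<open>g\<close>, \<open>\<psi>\<^sub>t = Id + t \<rho>(x)\<close> on \<open>h\<close> and \<open>S = \<partial>\<^sub>T x\<close>.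
  The three Nijenhuis conditions say exactly that the terms of order \<open>t\<^sup>2\<close> vanish in the
  conditions on \<open>(\<phi>\<^sub>t, \<psi>\<^sub>t)\<close> to be a homomorphism from \<open>T + t S\<close> to \<open>T\<close>: condition (i) makes
  \<open>\<phi>\<^sub>t\<close> a Lie algebra homomorphism, (ii) makes the pair compatible with \<open>\<rho>\<close>, and (iii) gives
  \<open>T \<circ> \<psi>\<^sub>t = \<phi>\<^sub>t \<circ> (T + t S)\<close>. That \<open>\<psi>\<^sub>t\<close> is a Lie algebra homomorphism is due to coherence:
  brackets with a value of \<open>\<rho>(x)\<close> vanish, and the derivation \<open>\<rho>(x)\<close> kills all brackets.

  The remaining point is that \<open>T + t S\<close> is an embedding tensor. Its defect
  \<open>D(t) = [(T + t S) u, (T + t S) v] - (T + t S) (\<rho>((T + t S) u) v + [u, v])\<close>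
  need not be expanded in terms of \<open>T\<close> and \<open>x\<close>. By the intertwining relations, \<open>\<phi>\<^sub>t\<close> maps \<open>D(t)\<close>
  to the defect of \<open>T\<close> at \<open>(\<psi>\<^sub>t u, \<psi>\<^sub>t v)\<close>, which is \<open>0\<close> (lemma \<open>intertwined_defect\<close>). The map
  \<open>\<phi>\<^sub>t\<close> may fail to be injective for particular \<open>t\<close>, but it is the identity at \<open>t = 0\<close>, hence
  injective on polynomials in \<open>t\<close>. Since \<open>D(t)\<close> is a polynomial in \<open>t\<close> without constant term,
  comparing the coefficients of \<open>\<phi>\<^sub>t (D(t)) = 0\<close> shows that \<open>D(t)\<close> vanishes
  (lemma \<open>perturbed_identity_kills_quadratic\<close>).
\<close>

section \<open>Bilinearity and derivations\<close>

lemma (in lie_algebra) bracket_linearity: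
  shows "bracket (a + b) c = bracket a c + bracket b c"
    and "bracket (a - b) c = bracket a c - bracket b c"
    and "bracket (scale r a) c = scale r (bracket a c)"
    and "bracket c (a + b) = bracket c a + bracket c b"
    and "bracket c (a - b) = bracket c a - bracket c b"
    and "bracket c (scale r a) = scale r (bracket c a)"
proof -
  interpret L: Vector_Spaces.linear scale scale "\<lambda>a. bracket a c"
    by (rule linear_bracket_left)
  interpret R: Vector_Spaces.linear scale scale "\<lambda>a. bracket c a"
    by (rule linear_bracket_right)
  show "bracket (a + b) c = bracket a c + bracket b c"
    and "bracket (a - b) c = bracket a c - bracket b c"
    and "bracket (scale r a) c = scale r (bracket a c)"
    by (fact L.add L.diff L.scale)+
  show "bracket c (a + b) = bracket c a + bracket c b"
    and "bracket c (a - b) = bracket c a - bracket c b"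
    and "bracket c (scale r a) = scale r (bracket c a)"
    by (fact R.add R.diff R.scale)+
qed

lemma (in lie_algebra) bracket_antisym: "bracket b a = - bracket a b"
proof -
  have "bracket b a + bracket a b = bracket (a + b) (a + b)"
    by (simp add: bracket_linearity bracket_self[of a] bracket_self[of b])
  also have "\<dots> = 0"
    by (rule bracket_self)
  finally have "bracket b a + bracket a b = 0" .
  then show ?thesis
    by (simp only: eq_neg_iff_add_eq_0)
qed

lemma (in lie_algebra) bracket_ad_derivation:
  "bracket x (bracket y z) = bracket (bracket x y) z + bracket y (bracket x z)"
proof -
  have "bracket y (bracket z x) = - bracket y (bracket x z)"
    using bracket_linearity(6)[of y "-1" "bracket x z"]
    by (simp add: bracket_antisym[of z x])
  then show ?thesis
    using jacobi[of x y z] by (simp add: bracket_antisym[of z "bracket x y"] algebra_simps)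
qed

lemma (in coherent_action) action_linearity:
  shows "\<rho> y (u + v) = \<rho> y u + \<rho> y v"
    and "\<rho> y (scaleh r u) = scaleh r (\<rho> y u)"
proof -
  interpret A: Vector_Spaces.linear scaleh scaleh "\<rho> y"
    using action_Der[of y] by (simp add: h.Der_def)
  show "\<rho> y (u + v) = \<rho> y u + \<rho> y v" and "\<rho> y (scaleh r u) = scaleh r (\<rho> y u)"
    by (fact A.add A.scale)+
qed

lemma (in coherent_action) bracket_action_right: "bracketh v (\<rho> y u) = 0"
  using h.bracket_antisym[of v "\<rho> y u"] coherent by simp

lemma (in coherent_action) action_bracket_eq_0: "\<rho> y (bracketh u v) = 0"
  using action_Der[of y] by (simp add: h.Der_def coherent bracket_action_right)

section \<open>Vanishing of a quadratic polynomial under a perturbed identity\<close>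

text \<open>
  A polynomial over a field of characteristic \<open>0\<close> with vector coefficients and degree at most
  \<open>3\<close> is zero if it vanishes at the four points \<open>0\<close>, \<open>1\<close>, \<open>-1\<close>, \<open>2\<close>.
\<close>

lemma cubic_coefficients_zero:
  fixes scale :: "'k::field_char_0 \<Rightarrow> 'a::ab_group_add \<Rightarrow> 'a"
  assumes "vector_space scale"
    and zero: "\<And>t. scale t a + scale (t^2) b + scale (t^3) c = 0"
  shows "a = 0" and "b = 0" and "c = 0"
proof -
  interpret vector_space scale by fact
  have one: "a + b + c = 0" and minus_one: "- a + b - c = 0"
    and two: "scale 2 a + scale 4 b + scale 8 c = 0"
    using zero[of 1] zero[of "-1"] zero[of 2] by simp_all
  have "scale 2 b = b + b"
    using scale_left_distrib[of 1 1 b] by simp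
  also have "b + b = (a + b + c) + (- a + b - c)"
    by simp
  finally have "scale 2 b = 0"
    by (simp only: one minus_one) simp
  then show b: "b = 0"
    by simp
  then have ac: "a = - c"
    using one by (simp add: eq_neg_iff_add_eq_0)
  (* the value at 2 becomes - 2 c + 8 c *)
  have "scale 6 c = scale 2 a + scale 8 c"
    using scale_left_distrib[of "-2" 8 c] by (simp add: ac)
  then show c: "c = 0"
    using two b by simp
  then show "a = 0"
    using ac by simp
qed

text \<open>
  The family \<open>Id + t N\<close> is invertible over formal power series in \<open>t\<close>, so it annihilates no
  nonzero polynomial.
\<close>

lemma perturbed_identity_kills_quadratic:
  fixes scale :: "'k::field_char_0 \<Rightarrow> 'a::ab_group_add \<Rightarrow> 'a"
  assumes "Vector_Spaces.linear scale scale N"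
    and D: "\<And>t. D t = scale t a + scale (t^2) b"
    and kill: "\<And>t. D t + scale t (N (D t)) = 0"
  shows "D t = 0"
proof -
  interpret Vector_Spaces.linear scale scale N by fact
  have "scale t a + scale (t^2) (b + N a) + scale (t^3) (N b) = 0" for t
    using kill[of t]
    by (simp add: D add scale power2_eq_square power3_eq_cube
        algebra_simps)
  note zero = cubic_coefficients_zero[OF vs1.vector_space_axioms this]
  from zero(1,2) show ?thesis
    by (simp add: D)
qed

section \<open>The homomorphism attached to a Nijenhuis element\<close>

context coherent_action
begin

lemma linear_coboundary:
  assumes "Vector_Spaces.linear scaleh scaleg T"
  shows "Vector_Spaces.linear scaleh scaleg (coboundary T x)"
proof -
  interpret T: Vector_Spaces.linear scaleh scaleg T by fact
  show ?thesis
    by unfold_locales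
      (simp_all add: coboundary_def action_linearity T.add T.scale g.bracket_linearity
        g.scale_right_diff_distrib)
qed

lemma linear_deform:
  assumes "Vector_Spaces.linear scaleh scaleg T" and "Vector_Spaces.linear scaleh scaleg S"
  shows "Vector_Spaces.linear scaleh scaleg (deform T S t)"
proof -
  interpret T: Vector_Spaces.linear scaleh scaleg T by fact
  interpret S: Vector_Spaces.linear scaleh scaleg S by fact
  show ?thesis
    by unfold_locales
      (simp_all add: deform_def T.add T.scale S.add S.scale g.scale_right_distrib
        mult.commute)
qed

text \<open>
  As \<open>ad\<^sub>x\<close> is a derivation, the multiplicativity of \<open>Id + t ad\<^sub>x\<close> can only fail by
  \<open>t\<^sup>2 [[x, y], [x, z]]\<close>.
\<close>

lemma lie_algebra_hom_Id_plus_ad: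
  assumes "\<And>y z. bracketg (bracketg x y) (bracketg x z) = 0"
  shows "lie_algebra_hom scaleg bracketg scaleg bracketg (\<lambda>y. y + scaleg t (bracketg x y))"
proof unfold_locales
  fix y z r
  let ?\<phi> = "\<lambda>y. y + scaleg t (bracketg x y)"
  show "?\<phi> (y + z) = ?\<phi> y + ?\<phi> z"
    by (simp add: g.bracket_linearity g.scale_right_distrib)
  show "?\<phi> (scaleg r y) = scaleg r (?\<phi> y)"
    by (simp add: g.bracket_linearity g.scale_right_distrib mult.commute)
  show "?\<phi> (bracketg y z) = bracketg (?\<phi> y) (?\<phi> z)"
    by (simp add: g.bracket_linearity assms g.bracket_ad_derivation[of x y z] g.scale_right_distrib)
qed

lemma lie_algebra_hom_Id_plus_action:
  "lie_algebra_hom scaleh bracketh scaleh bracketh (\<lambda>u. u + scaleh t (\<rho> x u))"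
proof unfold_locales
  fix u v r
  let ?\<psi> = "\<lambda>u. u + scaleh t (\<rho> x u)"
  show "?\<psi> (u + v) = ?\<psi> u + ?\<psi> v"
    by (simp add: action_linearity h.scale_right_distrib)
  show "?\<psi> (scaleh r u) = scaleh r (?\<psi> u)"
    by (simp add: action_linearity h.scale_right_distrib mult.commute)
  show "?\<psi> (bracketh u v) = bracketh (?\<psi> u) (?\<psi> v)"
    by (simp add: h.bracket_linearity action_bracket_eq_0 coherent bracket_action_right)
qed

text \<open>
  As \<open>\<rho>(x) \<rho>(y) = \<rho>([x, y]) + \<rho>(y) \<rho>(x)\<close>, the two sides can only differ by
  \<open>t\<^sup>2 \<rho>([x, y]) \<rho>(x)\<close>.
\<close>

lemma Id_plus_action_equivariant:
  assumes "\<And>y u. \<rho> (bracketg x y) (\<rho> x u) = 0"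
  shows "\<rho> y u + scaleh t (\<rho> x (\<rho> y u)) =
    \<rho> (y + scaleg t (bracketg x y)) (u + scaleh t (\<rho> x u))"
proof -
  have "\<rho> x (\<rho> y u) = \<rho> (bracketg x y) u + \<rho> y (\<rho> x u)"
    by (simp add: action_bracket)
  then show ?thesis
    by (simp add: action_add action_scale action_linearity assms h.scale_right_distrib)
qed

lemma deform_coboundary_intertwined:
  assumes T: "Vector_Spaces.linear scaleh scaleg T"
    and kill: "\<And>u. bracketg x (coboundary T x u) = 0"
  shows "T (u + scaleh t (\<rho> x u)) =
    deform T (coboundary T x) t u + scaleg t (bracketg x (deform T (coboundary T x) t u))"
proof -
  interpret T: Vector_Spaces.linear scaleh scaleg T by fact
  have "bracketg x (deform T (coboundary T x) t u) = bracketg x (T u)"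
    by (simp add: deform_def g.bracket_linearity kill)
  then show ?thesis
    by (simp add: deform_def coboundary_def T.add T.scale g.scale_right_diff_distrib)
qed

section \<open>The deformed map is an embedding tensor\<close>

text \<open>
  Everything entering the defect of \<open>T'\<close> is transported by \<open>(\<phi>, \<psi>)\<close> to the corresponding
  expression for \<open>T\<close>, where the defect is \<open>0\<close>.
\<close>

lemma intertwined_defect:
  assumes T: "nonabelian_embedding_tensor T"
    and \<phi>: "lie_algebra_hom scaleg bracketg scaleg bracketg \<phi>"
    and \<psi>: "lie_algebra_hom scaleh bracketh scaleh bracketh \<psi>"
    and comm: "\<And>u. T (\<psi> u) = \<phi> (T' u)"
    and equivariant: "\<And>y u. \<psi> (\<rho> y u) = \<rho> (\<phi> y) (\<psi> u)"
  shows "\<phi> (bracketg (T' u) (T' v) - T' (\<rho> (T' u) v + bracketh u v)) = 0"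
proof -
  interpret \<phi>: lie_algebra_hom scaleg bracketg scaleg bracketg \<phi> by fact
  interpret \<psi>: lie_algebra_hom scaleh bracketh scaleh bracketh \<psi> by fact
  have "\<phi> (bracketg (T' u) (T' v)) = bracketg (T (\<psi> u)) (T (\<psi> v))"
    by (simp add: \<phi>.hom_bracket comm)
  also have "\<dots> = T (\<rho> (T (\<psi> u)) (\<psi> v) + bracketh (\<psi> u) (\<psi> v))"
    using T by (simp add: nonabelian_embedding_tensor_def)
  also have "\<dots> = T (\<psi> (\<rho> (T' u) v + bracketh u v))"
    by (simp add: \<psi>.add \<psi>.hom_bracket equivariant comm)
  also have "\<dots> = \<phi> (T' (\<rho> (T' u) v + bracketh u v))"
    by (rule comm)
  finally show ?thesis
    by (simp add: \<phi>.diff)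
qed

text \<open>
  The constant term of the defect of \<open>T + t S\<close> is the defect of \<open>T\<close>, hence \<open>0\<close>; only the
  absence of this term matters later, not the shape of the two coefficients.
\<close>

lemma deform_defect_quadratic:
  assumes T: "nonabelian_embedding_tensor T" and S: "Vector_Spaces.linear scaleh scaleg S"
  shows "bracketg (deform T S t u) (deform T S t v)
      - deform T S t (\<rho> (deform T S t u) v + bracketh u v)
    = scaleg t (bracketg (S u) (T v) + bracketg (T u) (S v)
        - T (\<rho> (S u) v) - S (\<rho> (T u) v + bracketh u v))
      + scaleg (t^2) (bracketg (S u) (S v) - S (\<rho> (S u) v))"
proof -
  interpret T: Vector_Spaces.linear scaleh scaleg T
    using T by (simp add: nonabelian_embedding_tensor_def)
  interpret S: Vector_Spaces.linear scaleh scaleg S by fact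
  have "bracketg (T u) (T v) = T (\<rho> (T u) v) + T (bracketh u v)"
    using T by (simp add: nonabelian_embedding_tensor_def T.add)
  then show ?thesis
    by (simp add: deform_def g.bracket_linearity action_add action_scale T.add T.scale
        S.add S.scale power2_eq_square
        algebra_simps)
qed

lemma coboundary_trivial_linear_deformation:
  assumes T: "nonabelian_embedding_tensor T" and x: "x \<in> Nij T"
  shows "trivial_linear_deformation T (coboundary T x)"
proof -
  define S where "S = coboundary T x"
  define \<phi> where "\<phi> t y = y + scaleg t (bracketg x y)" for t y
  define \<psi> where "\<psi> t u = u + scaleh t (\<rho> x u)" for t u
  have linT: "Vector_Spaces.linear scaleh scaleg T"
    using T by (simp add: nonabelian_embedding_tensor_def)
  have linS: "Vector_Spaces.linear scaleh scaleg S"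
    unfolding S_def by (rule linear_coboundary[OF linT])
  have hom\<phi>: "lie_algebra_hom scaleg bracketg scaleg bracketg (\<phi> t)" for t
    unfolding \<phi>_def using x by (intro lie_algebra_hom_Id_plus_ad) (simp add: Nij_def)
  have hom\<psi>: "lie_algebra_hom scaleh bracketh scaleh bracketh (\<psi> t)" for t
    unfolding \<psi>_def by (rule lie_algebra_hom_Id_plus_action)
  have comm: "T (\<psi> t u) = \<phi> t (deform T S t u)" for t u
    unfolding \<phi>_def \<psi>_def S_def using x
    by (intro deform_coboundary_intertwined[OF linT]) (simp add: Nij_def coboundary_def)
  have equivariant: "\<psi> t (\<rho> y u) = \<rho> (\<phi> t y) (\<psi> t u)" for t y u
    unfolding \<phi>_def \<psi>_def using x by (intro Id_plus_action_equivariant) (simp add: Nij_def)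
  have tensor: "nonabelian_embedding_tensor (deform T S t)" for t
    unfolding nonabelian_embedding_tensor_def
  proof (intro conjI allI)
    show "Vector_Spaces.linear scaleh scaleg (deform T S t)"
      by (rule linear_deform[OF linT linS])
    fix u v
    define D where "D s = bracketg (deform T S s u) (deform T S s v)
      - deform T S s (\<rho> (deform T S s u) v + bracketh u v)" for s
    have "D s + scaleg s (bracketg x (D s)) = 0" for s
      using intertwined_defect[where \<phi> = "\<phi> s" and \<psi> = "\<psi> s",
          OF T hom\<phi> hom\<psi> comm equivariant]
      unfolding D_def \<phi>_def .
    then have "D t = 0"
      by (rule perturbed_identity_kills_quadratic[where D = D,
            OF g.linear_bracket_right[of x] deform_defect_quadratic[OF T linS, of _ u v,
              folded D_def]])
    then show "bracketg (deform T S t u) (deform T S t v)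
        = deform T S t (\<rho> (deform T S t u) v + bracketh u v)"
      by (simp add: D_def)
  qed
  have "embedding_tensor_hom (deform T S t) T (\<phi> t) (\<psi> t)" for t
    unfolding embedding_tensor_hom_def
    using tensor T hom\<phi> hom\<psi> comm equivariant by (auto simp: fun_eq_iff)
  then have "\<exists>x. \<forall>t. embedding_tensor_hom (deform T S t) T
      (\<lambda>y. y + scaleg t (bracketg x y)) (\<lambda>u. u + scaleh t (\<rho> x u))"
    unfolding \<phi>_def \<psi>_def by blast
  moreover have "generates_linear_deformation T S"
    unfolding generates_linear_deformation_def using linS tensor by blast
  ultimately show ?thesis
    unfolding trivial_linear_deformation_def S_def by blast
qed

end

theorem theorem6p6:
  fixes scaleg :: "complex \<Rightarrow> 'g::ab_group_add \<Rightarrow> 'g" and bracketg :: "'g \<Rightarrow> 'g \<Rightarrow> 'g"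
    and scaleh :: "complex \<Rightarrow> 'h::ab_group_add \<Rightarrow> 'h" and bracketh :: "'h \<Rightarrow> 'h \<Rightarrow> 'h"
    and \<rho> :: "'g \<Rightarrow> 'h \<Rightarrow> 'h" and T :: "'h \<Rightarrow> 'g" and x :: 'g
  assumes "coherent_action scaleg bracketg scaleh bracketh \<rho>"
    and "coherent_action.nonabelian_embedding_tensor scaleg bracketg scaleh bracketh \<rho> T"
    and "x \<in> coherent_action.Nij bracketg \<rho> T"
  shows "coherent_action.trivial_linear_deformation scaleg bracketg scaleh bracketh \<rho>
           T (coherent_action.coboundary bracketg \<rho> T x)"
  using assms by (rule coherent_action.coboundary_trivial_linear_deformation)

end
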